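(* Let $G$ be a simple graph of order $N$ and size (number of edges) $s>0$, and let $A_\sigma$ be its adjacency matrix under a fixed vertex labeling $\sigma$. Then $$\operatorname{FR}(A_\sigma)=\frac{\mathcal E(G)}{\sqrt{2s}}$$ if and only if every row and every column of $\widehat{A_\sigma}=FA_\sigma F$ contains at most one nonzero entry.
   Context: Graphs are finite, simple and undirected. A vertex labeling of a graph $G=(V,E)$ of order $N=|V|$ is a bijection $\sigma:V\to\mathbb Z_N=\mathbb Z/N\mathbb Z$. The adjacency matrix under $\sigma$ is the $N\times N$ matrix $A_\sigma$, indexed by $\mathbb Z_N\times\mathbb Z_N$, with $(A_\sigma)_{x,y}=1$ if the vertices labeled $x$ and $y$ are adjacent and $0$ otherwise. $F$ is the unitary Fourier matrix $F_{mx}=\frac1{\sqrt N}e^{-2\pi i mx/N}$, $m,x\in\mathbb Z_N$. For an $N\times N$ matrix $M$, write $\widehat M=FMF$; $\|M\|_1$ is the entrywise $\ell^1$-norm and $\|M\|_2$ is the Frobenius norm. The Fourier ratio of $M\ne0$ is $\operatorname{FR}(M)=\|\widehat M\|_1/\|\widehat M\|_2$. The graph energy is $\mathcal E(G)=\sum_{j=1}^N|\lambda_j(G)|$, where $\lambda_1(G),\dots,\lambda_N(G)$ are the adjacency eigenvalues with multiplicity. *)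

theory Defs
  imports Complex_Main "Jordan_Normal_Form.Char_Poly"
begin

definition simple_graph :: "'v set \<Rightarrow> 'v set set \<Rightarrow> bool" where
  "simple_graph V E \<longleftrightarrow> finite V \<and> (\<forall>e\<in>E. e \<subseteq> V \<and> card e = 2)"

text \<open>The elements of $\mathbb{Z}/N\mathbb{Z}$ are represented by the residues $0,\dots,N-1$.\<close>

definition vertex_labeling :: "'v set \<Rightarrow> ('v \<Rightarrow> nat) \<Rightarrow> bool" where
  "vertex_labeling V \<sigma> \<longleftrightarrow> bij_betw \<sigma> V {0..<card V}"

definition adjacency_mat :: "'v set \<Rightarrow> 'v set set \<Rightarrow> ('v \<Rightarrow> nat) \<Rightarrow> complex mat" where
  "adjacency_mat V E \<sigma> = mat (card V) (card V)
     (\<lambda>(x, y). if {inv_into V \<sigma> x, inv_into V \<sigma> y} \<in> E then 1 else 0)"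

definition fourier_mat :: "nat \<Rightarrow> complex mat" where
  "fourier_mat N = mat N N
     (\<lambda>(m, x). 1 / complex_of_real (sqrt (real N)) *
        exp (- 2 * complex_of_real pi * \<i> * of_nat m * of_nat x / of_nat N))"

text \<open>Both outer factors are the Fourier matrix itself, not its adjoint.  All matrices below are
  meant to be square.\<close>

definition fourier_hat :: "complex mat \<Rightarrow> complex mat" where
  "fourier_hat M = fourier_mat (dim_row M) * M * fourier_mat (dim_row M)"

definition l1_norm_mat :: "complex mat \<Rightarrow> real" where
  "l1_norm_mat M = (\<Sum>i<dim_row M. \<Sum>j<dim_col M. cmod (M $$ (i, j)))"

definition frobenius_norm_mat :: "complex mat \<Rightarrow> real" where
  "frobenius_norm_mat M = sqrt (\<Sum>i<dim_row M. \<Sum>j<dim_col M. (cmod (M $$ (i, j)))\<^sup>2)"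

text \<open>Only meaningful for nonzero \<open>M\<close>.\<close>

definition fourier_ratio :: "complex mat \<Rightarrow> real" where
  "fourier_ratio M = l1_norm_mat (fourier_hat M) / frobenius_norm_mat (fourier_hat M)"

text \<open>The eigenvalues with multiplicity are the multiset of complex roots of the characteristic
  polynomial of an adjacency matrix (they are in fact real).  An arbitrary labeling is chosen; the
  lemma \<open>graph_energy_eq\<close> below shows that the choice is irrelevant.\<close>

definition adjacency_eigenvalues :: "'v set \<Rightarrow> 'v set set \<Rightarrow> complex multiset" where
  "adjacency_eigenvalues V E =
     proots (char_poly (adjacency_mat V E (SOME \<sigma>. vertex_labeling V \<sigma>)))"

definition graph_energy :: "'v set \<Rightarrow> 'v set set \<Rightarrow> real" where
  "graph_energy V E = (\<Sum>z\<in>#adjacency_eigenvalues V E. cmod z)"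

lemma similar_adjacency_mat:
  assumes \<sigma>: "vertex_labeling V \<sigma>" and \<tau>: "vertex_labeling V \<tau>"
  shows "similar_mat (adjacency_mat V E \<sigma>) (adjacency_mat V E \<tau>)"
proof -
  define N where "N = card V"
  define p where "p x = \<tau> (inv_into V \<sigma> x)" for x
  define P :: "complex mat" where "P = mat N N (\<lambda>(i, j). if j = p i then 1 else 0)"
  define Q :: "complex mat" where "Q = mat N N (\<lambda>(i, j). if i = p j then 1 else 0)"
  have bs: "bij_betw \<sigma> V {0..<N}" and bt: "bij_betw \<tau> V {0..<N}"
    using \<sigma> \<tau> by (auto simp: vertex_labeling_def N_def)
  have bp: "bij_betw p {0..<N} {0..<N}"
    using bij_betw_trans[OF bij_betw_inv_into[OF bs] bt] by (simp add: p_def[abs_def] comp_def)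
  have p_lt: "p i < N" if "i < N" for i
    using bij_betwE[OF bp] that by auto
  have p_inj: "p i = p j \<longleftrightarrow> i = j" if "i < N" "j < N" for i j
    using bij_betw_imp_inj_on[OF bp] that by (auto simp: inj_on_def)
  have inv_p: "inv_into V \<tau> (p i) = inv_into V \<sigma> i" if "i < N" for i
  proof -
    have "inv_into V \<sigma> i \<in> V" using bij_betwE[OF bij_betw_inv_into[OF bs]] that by auto
    then show ?thesis using bij_betw_inv_into_left[OF bt] by (simp add: p_def)
  qed
  have carr: "P \<in> carrier_mat N N" "Q \<in> carrier_mat N N"
    "adjacency_mat V E \<sigma> \<in> carrier_mat N N" "adjacency_mat V E \<tau> \<in> carrier_mat N N"
    by (auto simp: P_def Q_def adjacency_mat_def N_def)
  have entry: "(X * Y) $$ (i, j) = (\<Sum>k = 0..<N. X $$ (i, k) * Y $$ (k, j))"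
    if "X \<in> carrier_mat N N" "Y \<in> carrier_mat N N" "i < N" "j < N" for X Y :: "complex mat" and i j
    using that by (auto simp: scalar_prod_def)
  have PQ: "P * Q = 1\<^sub>m N"
  proof (rule eq_matI)
    fix i j assume "i < dim_row (1\<^sub>m N)" "j < dim_col (1\<^sub>m N)"
    then have ij: "i < N" "j < N" by auto
    have "(P * Q) $$ (i, j) = (\<Sum>k = 0..<N. if k = p i then (if k = p j then 1 else 0) else 0)"
      unfolding P_def Q_def using ij
      by (simp add: scalar_prod_def if_distrib[of "\<lambda>c. c * _"] cong: if_cong)
    also have "\<dots> = (1\<^sub>m N) $$ (i, j)" using ij p_lt p_inj by simp
    finally show "(P * Q) $$ (i, j) = (1\<^sub>m N) $$ (i, j)" .
  qed (use carr in auto)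
  have QP: "Q * P = 1\<^sub>m N" by (rule mat_mult_left_right_inverse[OF carr(1,2) PQ])
  have PA: "(P * adjacency_mat V E \<tau>) $$ (i, j) = adjacency_mat V E \<tau> $$ (p i, j)"
    if ij: "i < N" "j < N" for i j
  proof -
    have "(P * adjacency_mat V E \<tau>) $$ (i, j)
        = (\<Sum>k = 0..<N. if k = p i then adjacency_mat V E \<tau> $$ (k, j) else 0)"
      unfolding P_def using ij carr(4)
      by (simp add: scalar_prod_def if_distrib[of "\<lambda>c. c * _"] cong: if_cong)
    also have "\<dots> = adjacency_mat V E \<tau> $$ (p i, j)" using ij p_lt by simp
    finally show ?thesis .
  qed
  have "adjacency_mat V E \<sigma> = P * adjacency_mat V E \<tau> * Q"
  proof (rule eq_matI)
    fix i j assume "i < dim_row (P * adjacency_mat V E \<tau> * Q)"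
      "j < dim_col (P * adjacency_mat V E \<tau> * Q)"
    then have ij: "i < N" "j < N" using carr by auto
    have "(P * adjacency_mat V E \<tau> * Q) $$ (i, j)
        = (\<Sum>k = 0..<N. (P * adjacency_mat V E \<tau>) $$ (i, k) * Q $$ (k, j))"
      by (rule entry) (use ij carr in auto)
    also have "\<dots> = (\<Sum>k = 0..<N. if k = p j then adjacency_mat V E \<tau> $$ (p i, k) else 0)"
      using ij by (intro sum.cong) (auto simp: PA Q_def)
    also have "\<dots> = adjacency_mat V E \<tau> $$ (p i, p j)" using ij p_lt by simp
    also have "\<dots> = adjacency_mat V E \<sigma> $$ (i, j)"
      using ij p_lt inv_p by (auto simp: adjacency_mat_def N_def)
    finally show "adjacency_mat V E \<sigma> $$ (i, j) = (P * adjacency_mat V E \<tau> * Q) $$ (i, j)" ..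
  qed (use carr in auto)
  then show ?thesis using carr PQ QP by (intro similar_matI[of _ _ P Q N]) auto
qed

lemma graph_energy_eq:
  assumes "vertex_labeling V \<sigma>"
  shows "graph_energy V E = (\<Sum>z\<in>#proots (char_poly (adjacency_mat V E \<sigma>)). cmod z)"
  unfolding graph_energy_def adjacency_eigenvalues_def
  using char_poly_similar[OF similar_adjacency_mat[OF someI[of "vertex_labeling V", OF assms] assms]]
  by simp

end

theory Submission
  imports Defs "Jordan_Normal_Form.Schur_Decomposition"
begin

text \<open>Diagonalise \<open>A = U D U\<^sup>*\<close>, so that \<open>B = F A F = P D Q\<close> with \<open>P = F U\<close> and \<open>Q = U\<^sup>* F\<close> unitary.
  As \<open>F\<close> is unitary, the Frobenius norm of \<open>B\<close> is that of \<open>A\<close>, and the claim becomes that the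
  entrywise norm of \<open>B\<close> equals the sum of the \<open>|d\<^sub>j|\<close> iff \<open>B\<close> is sparse.  For every \<open>X\<close>,
  \<open>tr (B X) = \<Sum>\<^sub>j d\<^sub>j (Q X P)\<^sub>j\<^sub>j\<close>.  A unitary \<open>X\<close> for which \<open>Q X P\<close> is the diagonal of the conjugate
  phases of \<open>d\<close> gives \<open>\<Sum> |d\<^sub>j| \<le> \<Sum> |B\<^sub>m\<^sub>k|\<close>; equality forces \<open>|X\<^sub>k\<^sub>m| = 1\<close> wherever \<open>B\<^sub>m\<^sub>k \<noteq> 0\<close>, and a
  row or column of a unitary matrix has at most one entry of modulus one.  Conversely, if \<open>B\<close> is
  sparse, the \<open>X\<close> formed from the conjugate phases of \<open>B\<close> is a contraction, which yields the
  opposite inequality.\<close>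

section \<open>Unitary matrices\<close>

lemma dim_mat_adjoint [simp]:
  "dim_row (mat_adjoint A) = dim_col A" "dim_col (mat_adjoint A) = dim_row A"
  by (auto simp: mat_adjoint_def mat_of_rows_def)

lemma mat_adjoint_carrier [simp]: "A \<in> carrier_mat m n \<Longrightarrow> mat_adjoint A \<in> carrier_mat n m"
  by (intro carrier_matI) simp_all

lemma index_mat_adjoint [simp]:
  fixes A :: "complex mat"
  assumes "i < dim_col A" "j < dim_row A"
  shows "mat_adjoint A $$ (i, j) = cnj (A $$ (j, i))"
  using assms by (simp add: mat_adjoint_def mat_of_rows_def)

lemma mat_adjoint_adjoint [simp]: "mat_adjoint (mat_adjoint A) = (A :: complex mat)"
  by (rule eq_matI) auto

lemma index_mult_mat_sum:
  assumes "A \<in> carrier_mat m k" "B \<in> carrier_mat k n" "i < m" "j < n"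
  shows "(A * B) $$ (i, j) = (\<Sum>l<k. A $$ (i, l) * B $$ (l, j))"
  using assms by (auto simp: scalar_prod_def lessThan_atLeast0)

lemma mat_adjoint_mult:
  fixes A B :: "complex mat"
  assumes "A \<in> carrier_mat m k" "B \<in> carrier_mat k n"
  shows "mat_adjoint (A * B) = mat_adjoint B * mat_adjoint A"
proof (rule eq_matI)
  fix i j assume "i < dim_row (mat_adjoint B * mat_adjoint A)" "j < dim_col (mat_adjoint B * mat_adjoint A)"
  then have ij: "i < n" "j < m" using assms by auto
  have "(mat_adjoint B * mat_adjoint A) $$ (i, j)
      = (\<Sum>l<k. mat_adjoint B $$ (i, l) * mat_adjoint A $$ (l, j))"
    using assms ij by (intro index_mult_mat_sum) auto
  then show "mat_adjoint (A * B) $$ (i, j) = (mat_adjoint B * mat_adjoint A) $$ (i, j)"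
    using ij assms index_mult_mat_sum[OF assms ij(2,1)] by (simp add: mult.commute)
qed (use assms in auto)

text \<open>For a square matrix a left inverse is also a right inverse, so one equation suffices;
  the other product is recovered in \<open>unitary_mat_mult_adjoint\<close>.\<close>

definition unitary_mat :: "nat \<Rightarrow> complex mat \<Rightarrow> bool" where
  "unitary_mat n U \<longleftrightarrow> U \<in> carrier_mat n n \<and> mat_adjoint U * U = 1\<^sub>m n"

lemma unitary_mat_carrier: "unitary_mat n U \<Longrightarrow> U \<in> carrier_mat n n"
  by (simp add: unitary_mat_def)

lemma unitary_mat_adjoint_mult: "unitary_mat n U \<Longrightarrow> mat_adjoint U * U = 1\<^sub>m n"
  by (simp add: unitary_mat_def)

lemma unitary_mat_mult_adjoint: "unitary_mat n U \<Longrightarrow> U * mat_adjoint U = 1\<^sub>m n"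
  unfolding unitary_mat_def by (rule mat_mult_left_right_inverse[of _ n]) auto

lemma unitary_mat_adjoint: "unitary_mat n U \<Longrightarrow> unitary_mat n (mat_adjoint U)"
  using unitary_mat_mult_adjoint[of n U] by (simp add: unitary_mat_def)

text \<open>Used with \<open>B = mat_adjoint U\<close> and \<open>C = U\<close>: it collapses the
  Gram matrix of a product whose left factor is unitary.\<close>

lemma mult_mat_cancel_middle:
  fixes A B C D :: "complex mat"
  assumes "A \<in> carrier_mat n n" "B \<in> carrier_mat n n" "C \<in> carrier_mat n n" "D \<in> carrier_mat n n"
    and "B * C = 1\<^sub>m n"
  shows "(A * B) * (C * D) = A * D"
proof -
  have "(A * B) * (C * D) = A * ((B * C) * D)"
    using assms(1-4) by (simp add: assoc_mult_mat[of _ n n _ n _ n])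
  then show ?thesis using assms by simp
qed

lemma unitary_mat_mult:
  assumes U: "unitary_mat n U" and W: "unitary_mat n W"
  shows "unitary_mat n (U * W)"
proof -
  note c = unitary_mat_carrier[OF U] unitary_mat_carrier[OF W]
  have "mat_adjoint (U * W) * (U * W) = mat_adjoint W * W"
    unfolding mat_adjoint_mult[OF c]
    by (rule mult_mat_cancel_middle[of _ n]) (use c unitary_mat_adjoint_mult[OF U] in auto)
  then show ?thesis using c unitary_mat_adjoint_mult[OF W] by (auto simp: unitary_mat_def)
qed

lemma cnj_mult_self: "cnj z * z = complex_of_real ((cmod z)\<^sup>2)"
  by (metis complex_norm_square mult.commute)

text \<open>Column norms are read off the diagonal of the Gram matrix, so whatever preserves the
  Gram matrix preserves them.\<close>

lemma sum_col_norm_sq: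
  fixes A :: "complex mat"
  assumes A: "A \<in> carrier_mat m n" and j: "j < n"
  shows "complex_of_real (\<Sum>i<m. (cmod (A $$ (i, j)))\<^sup>2) = (mat_adjoint A * A) $$ (j, j)"
proof -
  have "(mat_adjoint A * A) $$ (j, j) = (\<Sum>i<m. mat_adjoint A $$ (j, i) * A $$ (i, j))"
    using A j by (intro index_mult_mat_sum) auto
  also have "\<dots> = (\<Sum>i<m. complex_of_real ((cmod (A $$ (i, j)))\<^sup>2))"
    using A j by (intro sum.cong) (auto simp: cnj_mult_self)
  finally show ?thesis by simp
qed

lemma unitary_mat_col_norm:
  assumes "unitary_mat n U" "j < n"
  shows "(\<Sum>i<n. (cmod (U $$ (i, j)))\<^sup>2) = 1"
proof -
  have "complex_of_real (\<Sum>i<n. (cmod (U $$ (i, j)))\<^sup>2) = 1"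
    unfolding sum_col_norm_sq[OF unitary_mat_carrier[OF assms(1)] assms(2)]
    using assms by (simp add: unitary_mat_adjoint_mult)
  then show ?thesis using of_real_eq_1_iff by blast
qed

lemma unitary_mat_row_norm:
  assumes "unitary_mat n U" "i < n"
  shows "(\<Sum>j<n. (cmod (U $$ (i, j)))\<^sup>2) = 1"
  using unitary_mat_col_norm[OF unitary_mat_adjoint[OF assms(1)] assms(2)]
    unitary_mat_carrier[OF assms(1)] assms(2) by simp

lemma frobenius_norm_mat_adjoint: "frobenius_norm_mat (mat_adjoint A) = frobenius_norm_mat A"
  unfolding frobenius_norm_mat_def by (subst sum.swap) simp

text \<open>\<open>U * A\<close> and \<open>A\<close> have the same Gram matrix, hence equal column
  norms, and these add up to the squared Frobenius norm.\<close>

lemma frobenius_norm_mat_unitary_left: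
  assumes U: "unitary_mat n U" and A: "A \<in> carrier_mat n n"
  shows "frobenius_norm_mat (U * A) = frobenius_norm_mat A"
proof -
  note UC = unitary_mat_carrier[OF U]
  have *: "(frobenius_norm_mat M)\<^sup>2 = (\<Sum>j<n. \<Sum>i<n. (cmod (M $$ (i, j)))\<^sup>2)"
    if "M \<in> carrier_mat n n" for M
    using that by (subst sum.swap) (simp add: frobenius_norm_mat_def sum_nonneg)
  have "mat_adjoint (U * A) * (U * A) = mat_adjoint A * A"
    unfolding mat_adjoint_mult[OF UC A]
    by (rule mult_mat_cancel_middle[of _ n]) (use UC A unitary_mat_adjoint_mult[OF U] in auto)
  then have "complex_of_real (\<Sum>i<n. (cmod ((U * A) $$ (i, j)))\<^sup>2)
      = complex_of_real (\<Sum>i<n. (cmod (A $$ (i, j)))\<^sup>2)" if "j < n" for j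
    unfolding sum_col_norm_sq[OF A that] sum_col_norm_sq[OF mult_carrier_mat[OF UC A] that] by simp
  then have "(frobenius_norm_mat (U * A))\<^sup>2 = (frobenius_norm_mat A)\<^sup>2"
    unfolding *[OF A] *[OF mult_carrier_mat[OF UC A]] of_real_eq_iff by simp
  then show ?thesis
    by (simp add: frobenius_norm_mat_def sum_nonneg)
qed

lemma frobenius_norm_mat_unitary_right:
  assumes U: "unitary_mat n U" and A: "A \<in> carrier_mat n n"
  shows "frobenius_norm_mat (A * U) = frobenius_norm_mat A"
proof -
  have "frobenius_norm_mat (A * U) = frobenius_norm_mat (mat_adjoint U * mat_adjoint A)"
    unfolding mat_adjoint_mult[OF A unitary_mat_carrier[OF U], symmetric]
    by (rule frobenius_norm_mat_adjoint[symmetric])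
  also have "\<dots> = frobenius_norm_mat (mat_adjoint A)"
    by (rule frobenius_norm_mat_unitary_left[OF unitary_mat_adjoint[OF U] mat_adjoint_carrier[OF A]])
  finally show ?thesis by (simp add: frobenius_norm_mat_adjoint)
qed

section \<open>The spectral theorem for Hermitian matrices\<close>

text \<open>Over the complex numbers the characteristic polynomial splits into \<open>n\<close>
  linear factors, so for \<open>n > 0\<close> it has a root.\<close>

lemma exists_eigenvector:
  fixes A :: "complex mat"
  assumes A: "A \<in> carrier_mat n n" and n: "n > 0"
  obtains v e where "eigenvector A v e"
proof -
  obtain as where as: "char_poly A = (\<Prod>a\<leftarrow>as. [:- a, 1:])" "length as = n"
    using char_poly_factorized[OF A] by blast
  then obtain e es where "as = e # es" using n by (cases as) auto
  with as have "poly (char_poly A) e = 0" by simp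
  then show ?thesis
    using that eigenvalue_root_char_poly[OF A, of e] unfolding eigenvalue_def by blast
qed

lemma vec_normalize:
  fixes v :: "complex vec"
  assumes "v \<bullet>c v \<noteq> 0"
  obtains c where "c \<noteq> 0" "cnj c * c * (v \<bullet>c v) = 1"
proof -
  define r where "r = (\<Sum>i = 0..<dim_vec v. (cmod (v $ i))\<^sup>2)"
  have "v \<bullet>c v = (\<Sum>i = 0..<dim_vec v. complex_of_real ((cmod (v $ i))\<^sup>2))"
    unfolding scalar_prod_def by (intro sum.cong) (auto simp: cnj_mult_self mult.commute[of _ "cnj _"])
  then have r: "v \<bullet>c v = complex_of_real r" by (simp add: r_def)
  have "r \<ge> 0" by (simp add: r_def sum_nonneg)
  moreover have "r \<noteq> 0" using assms r by auto
  ultimately have r0: "r > 0" by simp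
  let ?c = "complex_of_real (1 / sqrt r)"
  have "1 / sqrt r * (1 / sqrt r) * r = 1" using r0 by (simp add: field_simps)
  then have "cnj ?c * ?c * (v \<bullet>c v) = 1"
    unfolding r complex_cnj_complex_of_real of_real_mult[symmetric] by simp
  moreover have "?c \<noteq> 0" using r0 by simp
  ultimately show ?thesis by (rule that[rotated])
qed

text \<open>Complete \<open>v\<close> to a basis, apply Gram-Schmidt, which keeps the first vector,
  and normalise the columns. The scalar \<open>c\<close> is the normalising factor of
  \<open>v\<close>.\<close>

lemma unitary_mat_first_col:
  fixes v :: "complex vec"
  assumes v: "v \<in> carrier_vec n" and v0: "v \<noteq> 0\<^sub>v n"
  obtains W c where "unitary_mat n W" "c \<noteq> 0" "col W 0 = c \<cdot>\<^sub>v v"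
proof -
  have n: "n \<noteq> 0"
  proof
    assume "n = 0"
    with v v0 show False by (auto intro: eq_vecI)
  qed
  interpret cof_vec_space n "TYPE(complex)" .
  define b where "b = basis_completion v"
  define ws where "ws = gram_schmidt n b"
  from basis_completion[OF v v0, folded b_def]
  have b: "distinct b" "\<not> lin_dep (set b)" "set b \<subseteq> carrier_vec n" "hd b = v" "length b = n"
    by auto
  from b(4,5) n obtain vs where bv: "b = v # vs" by (cases b) auto
  from gram_schmidt_result[OF b(3,1,2) refl, folded ws_def]
  have ws: "set ws \<subseteq> carrier_vec n" "corthogonal ws" "length ws = n" by (auto simp: b(5))
  have "hd ws = v" using gram_schmidt_hd[OF v, of vs, folded bv] by (simp add: ws_def)
  then have ws0: "ws ! 0 = v" using ws(3) n by (cases ws) auto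
  have wsc: "ws ! i \<in> carrier_vec n" if "i < n" for i using ws that by auto
  \<comment> \<open>\<open>corthogonal\<close> is an equivalence: besides orthogonality it says that
    no \<open>ws ! i\<close> is null, which the normalisation needs.\<close>
  have orth: "ws ! i \<bullet>c ws ! j = 0 \<longleftrightarrow> i \<noteq> j" if "i < n" "j < n" for i j
    using corthogonalD[OF ws(2)] ws(3) that by auto
  have "\<exists>c. c \<noteq> 0 \<and> cnj c * c * (ws ! i \<bullet>c ws ! i) = 1" if "i < n" for i
    using vec_normalize[of "ws ! i"] orth[OF that that] by metis
  then obtain c where c: "\<And>i. i < n \<Longrightarrow> c i \<noteq> 0"
    "\<And>i. i < n \<Longrightarrow> cnj (c i) * c i * (ws ! i \<bullet>c ws ! i) = 1" by metis
  define W where "W = mat n n (\<lambda>(i, j). c j * (ws ! j) $ i)"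
  have W: "W \<in> carrier_mat n n" by (simp add: W_def)
  have "mat_adjoint W * W = 1\<^sub>m n"
  proof (rule eq_matI)
    fix i j assume "i < dim_row (1\<^sub>m n)" "j < dim_col (1\<^sub>m n)"
    then have ij: "i < n" "j < n" by auto
    have "(mat_adjoint W * W) $$ (i, j) = (\<Sum>l<n. mat_adjoint W $$ (i, l) * W $$ (l, j))"
      using W ij by (intro index_mult_mat_sum) auto
    also have "\<dots> = (\<Sum>l<n. cnj (c i) * c j * ((ws ! j) $ l * cnj ((ws ! i) $ l)))"
      using W ij by (intro sum.cong) (auto simp: W_def)
    also have "\<dots> = cnj (c i) * c j * (ws ! j \<bullet>c ws ! i)"
      using wsc[OF ij(1)] by (simp add: scalar_prod_def sum_distrib_left lessThan_atLeast0)
    also have "\<dots> = (1\<^sub>m n) $$ (i, j)" using orth[OF ij(2,1)] c(2)[OF ij(1)] ij by auto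
    finally show "(mat_adjoint W * W) $$ (i, j) = (1\<^sub>m n) $$ (i, j)" .
  qed (use W in auto)
  then have "unitary_mat n W" using W by (simp add: unitary_mat_def)
  moreover have "col W 0 = c 0 \<cdot>\<^sub>v v"
    using n v ws0 by (intro eq_vecI) (auto simp: W_def)
  ultimately show ?thesis using that c(1) n by blast
qed

lemma mat_adjoint_four_block_diag:
  fixes A B :: "complex mat"
  assumes "A \<in> carrier_mat m m" "B \<in> carrier_mat n n"
  shows "mat_adjoint (four_block_mat A (0\<^sub>m m n) (0\<^sub>m n m) B)
    = four_block_mat (mat_adjoint A) (0\<^sub>m m n) (0\<^sub>m n m) (mat_adjoint B)"
  by (rule eq_matI) (use assms in auto)

lemma mult_four_block_diag:
  fixes A B C D :: "complex mat"
  assumes "A \<in> carrier_mat m m" "B \<in> carrier_mat n n" "C \<in> carrier_mat m m" "D \<in> carrier_mat n n"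
  shows "four_block_mat A (0\<^sub>m m n) (0\<^sub>m n m) B * four_block_mat C (0\<^sub>m m n) (0\<^sub>m n m) D
    = four_block_mat (A * C) (0\<^sub>m m n) (0\<^sub>m n m) (B * D)"
  using assms by (subst mult_four_block_mat[of _ m m _ n _ n]) auto

lemma mat_adjoint_conjugate:
  fixes A W :: "complex mat"
  assumes "A \<in> carrier_mat n n" "W \<in> carrier_mat n n" "mat_adjoint A = A"
  shows "mat_adjoint (mat_adjoint W * A * W) = mat_adjoint W * A * W"
proof -
  have "mat_adjoint (mat_adjoint W * A * W) = mat_adjoint W * mat_adjoint (mat_adjoint W * A)"
    by (rule mat_adjoint_mult[of _ n n _ n]) (use assms(1,2) in auto)
  also have "mat_adjoint (mat_adjoint W * A) = A * W"
    using mat_adjoint_mult[OF mat_adjoint_carrier[OF assms(2)] assms(1)] assms(3) by simp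
  finally show ?thesis using assms(1,2) by (simp add: assoc_mult_mat[of _ n n _ n _ n])
qed

text \<open>With an eigenvector as first column of \<open>W\<close>, the first column of the
  conjugated matrix is \<open>e\<close> followed by zeros. Conjugation keeps the matrix Hermitian,
  so the first row vanishes off the diagonal too and the remaining block is Hermitian.\<close>

lemma unitary_deflation:
  fixes A :: "complex mat"
  assumes A: "A \<in> carrier_mat (Suc n) (Suc n)" and herm: "mat_adjoint A = A"
  obtains W e B where "unitary_mat (Suc n) W" "B \<in> carrier_mat n n" "mat_adjoint B = B"
    "mat_adjoint W * A * W = four_block_mat (mat 1 1 (\<lambda>_. e)) (0\<^sub>m 1 n) (0\<^sub>m n 1) B"
proof -
  obtain v e where ev: "eigenvector A v e" using exists_eigenvector[OF A] by blast
  then have v: "v \<in> carrier_vec (Suc n)" "v \<noteq> 0\<^sub>v (Suc n)" and Av: "A *\<^sub>v v = e \<cdot>\<^sub>v v"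
    using A by (auto simp: eigenvector_def)
  obtain W c where WU: "unitary_mat (Suc n) W" and c: "col W 0 = c \<cdot>\<^sub>v v"
    using unitary_mat_first_col[OF v] by blast
  note W = unitary_mat_carrier[OF WU]
  define A' where "A' = mat_adjoint W * A * W"
  have A': "A' \<in> carrier_mat (Suc n) (Suc n)" using A W by (auto simp: A'_def)
  have A'h: "mat_adjoint A' = A'" unfolding A'_def by (rule mat_adjoint_conjugate[OF A W herm])
  have hsym: "A' $$ (i, j) = cnj (A' $$ (j, i))" if "i < Suc n" "j < Suc n" for i j
    using arg_cong[OF A'h, of "\<lambda>M. M $$ (i, j)"] A' that by simp
  have "col (A * W) 0 = A *\<^sub>v col W 0" using A W by (intro col_mult2) auto
  also have "\<dots> = e \<cdot>\<^sub>v col W 0"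
    unfolding c using A v Av by (simp add: mult_mat_vec smult_smult_assoc mult.commute)
  finally have "col (A * W) 0 = e \<cdot>\<^sub>v col W 0" .
  then have AW: "(A * W) $$ (l, 0) = e * W $$ (l, 0)" if "l < Suc n" for l
    using A W that by (auto dest: arg_cong[where f = "\<lambda>u. u $ l"])
  have col0: "A' $$ (i, 0) = (if i = 0 then e else 0)" if i: "i < Suc n" for i
  proof -
    have "A' $$ (i, 0) = (mat_adjoint W * (A * W)) $$ (i, 0)"
      unfolding A'_def using A W by (simp add: assoc_mult_mat[of _ "Suc n" "Suc n" _ "Suc n" _ "Suc n"])
    also have "\<dots> = (\<Sum>l<Suc n. mat_adjoint W $$ (i, l) * (A * W) $$ (l, 0))"
      by (rule index_mult_mat_sum[of _ "Suc n" _ _ "Suc n"]) (use A W i in auto)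
    also have "\<dots> = e * (\<Sum>l<Suc n. mat_adjoint W $$ (i, l) * W $$ (l, 0))"
      unfolding sum_distrib_left using AW by (intro sum.cong) auto
    also have "(\<Sum>l<Suc n. mat_adjoint W $$ (i, l) * W $$ (l, 0)) = (mat_adjoint W * W) $$ (i, 0)"
      by (rule index_mult_mat_sum[of _ "Suc n" _ _ "Suc n", symmetric]) (use W i in auto)
    finally show ?thesis using i by (simp add: unitary_mat_adjoint_mult[OF WU])
  qed
  have row0: "A' $$ (0, i) = (if i = 0 then e else 0)" if i: "i < Suc n" for i
    using col0[OF i] hsym[of 0 i] col0[of 0] hsym[of 0 0] i by (auto split: if_splits)
  define B where "B = mat n n (\<lambda>(i, j). A' $$ (Suc i, Suc j))"
  have "B \<in> carrier_mat n n" by (simp add: B_def)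
  moreover have "mat_adjoint B = B"
    by (rule eq_matI) (auto simp: B_def intro: hsym[symmetric])
  moreover have "A' = four_block_mat (mat 1 1 (\<lambda>_. e)) (0\<^sub>m 1 n) (0\<^sub>m n 1) B"
    by (rule eq_matI) (use A' col0 row0 in \<open>auto simp: B_def\<close>)
  ultimately show ?thesis using that WU unfolding A'_def by blast
qed

text \<open>Induction on the size: deflate by one eigenvector, diagonalise the smaller block, and
  extend its unitary by a leading 1. The diagonal is left complex, since only the moduli of its
  entries matter later.\<close>

theorem hermitian_spectral_theorem:
  fixes A :: "complex mat"
  assumes "A \<in> carrier_mat n n" "mat_adjoint A = A"
  shows "\<exists>U d. unitary_mat n U \<and> A = U * mat_diag n d * mat_adjoint U"
  using assms
proof (induction n arbitrary: A)
  case 0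
  have "unitary_mat 0 (1\<^sub>m 0)" by (auto simp: unitary_mat_def intro: eq_matI)
  moreover have "A = 1\<^sub>m 0 * mat_diag 0 d * mat_adjoint (1\<^sub>m 0)" for d
    using 0 by (intro eq_matI) auto
  ultimately show ?case by blast
next
  case (Suc n)
  obtain W e B where WU: "unitary_mat (Suc n) W" and B: "B \<in> carrier_mat n n" "mat_adjoint B = B"
    and A': "mat_adjoint W * A * W = four_block_mat (mat 1 1 (\<lambda>_. e)) (0\<^sub>m 1 n) (0\<^sub>m n 1) B"
    using unitary_deflation[OF Suc.prems] by blast
  obtain U d where UU: "unitary_mat n U" and BU: "B = U * mat_diag n d * mat_adjoint U"
    using Suc.IH[OF B] by blast
  note W = unitary_mat_carrier[OF WU] and U = unitary_mat_carrier[OF UU]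
  \<comment> \<open>The block sum of a 1 by 1 and an \<open>n\<close> by \<open>n\<close> matrix. It
    respects products and, for \<open>K (1\<^sub>m 1) U\<close>, adjoints, so the equations for
    \<open>U\<close> lift to size \<open>Suc n\<close>.\<close>
  define K where "K X Y = four_block_mat X (0\<^sub>m 1 n) (0\<^sub>m n 1) Y" for X Y :: "complex mat"
  have KC: "K X Y \<in> carrier_mat (Suc n) (Suc n)"
    if "X \<in> carrier_mat 1 1" "Y \<in> carrier_mat n n" for X Y
    using that unfolding K_def by auto
  have KM: "K X Y * K X' Y' = K (X * X') (Y * Y')"
    if "X \<in> carrier_mat 1 1" "Y \<in> carrier_mat n n" "X' \<in> carrier_mat 1 1" "Y' \<in> carrier_mat n n"
    for X Y X' Y'
    unfolding K_def by (rule mult_four_block_diag) (use that in auto)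
  have adj1: "mat_adjoint (1\<^sub>m 1) = (1\<^sub>m 1 :: complex mat)" by (rule eq_matI) auto
  have KA: "mat_adjoint (K (1\<^sub>m 1) U) = K (1\<^sub>m 1) (mat_adjoint U)"
    unfolding K_def using mat_adjoint_four_block_diag[of "1\<^sub>m 1" 1 U n] U adj1 by simp
  have KU: "unitary_mat (Suc n) (K (1\<^sub>m 1) U)"
  proof -
    have "K (1\<^sub>m 1) (1\<^sub>m n) = 1\<^sub>m (Suc n)" unfolding K_def by (rule eq_matI) auto
    moreover have "mat_adjoint (K (1\<^sub>m 1) U) * K (1\<^sub>m 1) U = K (1\<^sub>m 1 * 1\<^sub>m 1) (mat_adjoint U * U)"
      unfolding KA by (rule KM) (use U in auto)
    moreover have "K (1\<^sub>m 1) U \<in> carrier_mat (Suc n) (Suc n)" by (rule KC) (use U in auto)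
    ultimately show ?thesis
      by (simp only: unitary_mat_def unitary_mat_adjoint_mult[OF UU] left_mult_one_mat[OF one_carrier_mat])
  qed
  let ?E = "mat 1 1 (\<lambda>_. e)"
  \<comment> \<open>\<open>case_nat e d\<close> puts the deflated eigenvalue at index 0 and shifts
    \<open>d\<close> by one.\<close>
  have diag: "K ?E (mat_diag n d) = mat_diag (Suc n) (case_nat e d)"
    unfolding K_def by (rule eq_matI) (auto simp: mat_diag_def split: nat.split)
  have KB: "K ?E B = K (1\<^sub>m 1) U * K ?E (mat_diag n d) * mat_adjoint (K (1\<^sub>m 1) U)"
  proof -
    have "K (1\<^sub>m 1) U * K ?E (mat_diag n d) = K (1\<^sub>m 1 * ?E) (U * mat_diag n d)"
      by (rule KM) (use U in auto)
    moreover have "K (1\<^sub>m 1 * ?E) (U * mat_diag n d) * K (1\<^sub>m 1) (mat_adjoint U)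
        = K (1\<^sub>m 1 * ?E * 1\<^sub>m 1) (U * mat_diag n d * mat_adjoint U)"
      by (rule KM) (use U in auto)
    moreover have "1\<^sub>m 1 * ?E * 1\<^sub>m 1 = ?E" by simp
    ultimately show ?thesis unfolding KA BU by simp
  qed
  define Z where "Z = W * K (1\<^sub>m 1) U"
  note KUC = unitary_mat_carrier[OF KU]
  have ZU: "unitary_mat (Suc n) Z" unfolding Z_def by (rule unitary_mat_mult[OF WU KU])
  let ?n = "Suc n"
  note assoc = assoc_mult_mat[of _ ?n ?n _ ?n _ ?n] mult_carrier_mat[of _ ?n ?n _ ?n]
  have DC: "mat_diag ?n (case_nat e d) \<in> carrier_mat ?n ?n" by simp
  have WW: "W * (mat_adjoint W * A * W) * mat_adjoint W = A"
  proof -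
    have "W * (mat_adjoint W * A * W) * mat_adjoint W
        = (W * mat_adjoint W) * A * (W * mat_adjoint W)"
      using W Suc.prems(1) by (simp add: assoc)
    then show ?thesis using Suc.prems(1) by (simp add: unitary_mat_mult_adjoint[OF WU])
  qed
  have "A = W * (K (1\<^sub>m 1) U * mat_diag ?n (case_nat e d) * mat_adjoint (K (1\<^sub>m 1) U)) * mat_adjoint W"
    using WW KB unfolding A' K_def[symmetric] diag by simp
  also have "\<dots> = Z * mat_diag ?n (case_nat e d) * mat_adjoint Z"
    unfolding Z_def mat_adjoint_mult[OF W KUC] using W KUC DC by (simp add: assoc)
  finally show ?case using ZU by blast
qed

section \<open>Characteristic roots of a unitarily diagonalised matrix\<close>

lemma proots_prod_linear:
  "proots (\<Prod>a\<leftarrow>as. [:- a, 1:] :: 'a :: idom poly) = mset as"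
proof (induction as)
  case (Cons a as)
  have "(\<Prod>a\<leftarrow>as. [:- a, 1:]) \<noteq> 0" by (auto simp: prod_list_zero_iff)
  then have "proots ([:- a, 1:] * (\<Prod>a\<leftarrow>as. [:- a, 1:])) = {#a#} + mset as"
    by (subst proots_mult) (use Cons in auto)
  then show ?case by simp
qed simp

text \<open>\<open>A\<close> is similar to a diagonal matrix, whose characteristic roots are its
  diagonal entries with multiplicity. This expresses the energy through the \<open>d\<close> of the
  spectral theorem.\<close>

lemma sum_cmod_proots_char_poly:
  assumes U: "unitary_mat n U" and A: "A = U * mat_diag n d * mat_adjoint U"
  shows "(\<Sum>z\<in>#proots (char_poly A). cmod z) = (\<Sum>j<n. cmod (d j))"
proof -
  note UC = unitary_mat_carrier[OF U]
  have "similar_mat A (mat_diag n d)"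
    by (rule similar_matI[of _ _ U "mat_adjoint U" n])
      (use UC A unitary_mat_adjoint_mult[OF U] unitary_mat_mult_adjoint[OF U] in auto)
  then have "char_poly A = char_poly (mat_diag n d)" by (rule char_poly_similar)
  also have "\<dots> = (\<Prod>a\<leftarrow>diag_mat (mat_diag n d). [:- a, 1:])"
    by (rule char_poly_upper_triangular[of _ n]) (auto simp: mat_diag_def)
  also have "diag_mat (mat_diag n d) = map d [0..<n]"
    by (auto simp: diag_mat_def mat_diag_def)
  finally show ?thesis
    by (simp only: proots_prod_linear)
      (simp add: sum_mset_sum_list sum_list_distinct_conv_sum_set lessThan_atLeast0 comp_def
        flip: mset_map)
qed


section \<open>The entrywise norm and the absolute values of the eigenvalues\<close>

text \<open>Cyclicity of the trace, written out entrywise: the trace of \<open>P D Q X\<close> is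
  that of \<open>D (Q X P)\<close>.\<close>

lemma trace_pairing_diag:
  fixes P Q X :: "complex mat"
  assumes P: "P \<in> carrier_mat n n" and Q: "Q \<in> carrier_mat n n" and X: "X \<in> carrier_mat n n"
  shows "(\<Sum>m<n. \<Sum>k<n. (P * mat_diag n d * Q) $$ (m, k) * X $$ (k, m))
    = (\<Sum>j<n. d j * (Q * X * P) $$ (j, j))"
proof -
  have PDQ: "(P * mat_diag n d * Q) $$ (m, k) = (\<Sum>j<n. P $$ (m, j) * d j * Q $$ (j, k))"
    if "m < n" "k < n" for m k
    using that P Q index_mult_mat_sum[of "P * mat_diag n d" n n Q n m k]
    by (simp add: mat_diag_mult_right)
  have QXP: "(Q * X * P) $$ (j, j) = (\<Sum>m<n. \<Sum>k<n. Q $$ (j, k) * X $$ (k, m) * P $$ (m, j))"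
    if "j < n" for j
  proof -
    have "(Q * X * P) $$ (j, j) = (\<Sum>m<n. (Q * X) $$ (j, m) * P $$ (m, j))"
      using that P Q X by (intro index_mult_mat_sum) auto
    also have "\<dots> = (\<Sum>m<n. (\<Sum>k<n. Q $$ (j, k) * X $$ (k, m)) * P $$ (m, j))"
      using that by (intro sum.cong) (auto simp only: index_mult_mat_sum[OF Q X] lessThan_iff)
    finally show ?thesis by (simp add: sum_distrib_right)
  qed
  have "(\<Sum>m<n. \<Sum>k<n. (P * mat_diag n d * Q) $$ (m, k) * X $$ (k, m))
      = (\<Sum>m<n. \<Sum>k<n. \<Sum>j<n. d j * (Q $$ (j, k) * X $$ (k, m) * P $$ (m, j)))"
    by (intro sum.cong refl) (simp add: PDQ sum_distrib_left sum_distrib_right mult_ac)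
  also have "\<dots> = (\<Sum>m<n. \<Sum>j<n. \<Sum>k<n. d j * (Q $$ (j, k) * X $$ (k, m) * P $$ (m, j)))"
    by (intro sum.cong refl sum.swap)
  also have "\<dots> = (\<Sum>j<n. \<Sum>m<n. \<Sum>k<n. d j * (Q $$ (j, k) * X $$ (k, m) * P $$ (m, j)))"
    by (rule sum.swap)
  also have "\<dots> = (\<Sum>j<n. d j * (Q * X * P) $$ (j, j))"
    by (intro sum.cong refl) (simp add: QXP sum_distrib_left)
  finally show ?thesis .
qed

text \<open>The pairwise form says that both coordinate projections are injective on the support of
  \<open>B\<close>, which is how it is used; \<open>sparse_mat_iff_card\<close> converts it to
  cardinalities.\<close>

definition sparse_mat :: "nat \<Rightarrow> complex mat \<Rightarrow> bool" where
  "sparse_mat n B \<longleftrightarrow>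
    (\<forall>m<n. \<forall>k<n. \<forall>k'<n. B $$ (m, k) \<noteq> 0 \<longrightarrow> B $$ (m, k') \<noteq> 0 \<longrightarrow> k = k') \<and>
    (\<forall>k<n. \<forall>m<n. \<forall>m'<n. B $$ (m, k) \<noteq> 0 \<longrightarrow> B $$ (m', k) \<noteq> 0 \<longrightarrow> m = m')"

lemma unitary_mat_diag:
  assumes "\<And>j. j < n \<Longrightarrow> cmod (f j) = 1"
  shows "unitary_mat n (mat_diag n f)"
proof -
  have "mat_adjoint (mat_diag n f) = mat_diag n (\<lambda>j. cnj (f j))"
    by (rule eq_matI) (auto simp: mat_diag_def)
  moreover have "mat_diag n (\<lambda>j. cnj (f j) * f j) = 1\<^sub>m n"
    by (rule eq_matI) (use assms in \<open>auto simp: mat_diag_def cnj_mult_self\<close>)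
  ultimately show ?thesis by (simp add: unitary_mat_def)
qed

lemma exists_phase: "\<exists>u. cmod u = 1 \<and> z * u = complex_of_real (cmod z)"
proof (cases "z = 0")
  case True
  \<comment> \<open>Any value satisfies the equation at zero; 1 has modulus one, so phases taken
    along a diagonal always form a unitary matrix.\<close>
  then show ?thesis by (intro exI[of _ 1]) simp
next
  case False
  then have "z * cnj (sgn z) = complex_of_real (cmod z)"
    by (simp add: sgn_eq complex_norm_square[symmetric] power2_eq_square)
  then show ?thesis using False by (intro exI[of _ "cnj (sgn z)"]) (simp add: norm_sgn)
qed

lemma exists_dual_unitary:
  assumes P: "unitary_mat n P" and Q: "unitary_mat n Q"
  obtains X where "unitary_mat n X"
    "(\<Sum>m<n. \<Sum>k<n. (P * mat_diag n d * Q) $$ (m, k) * X $$ (k, m))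
      = complex_of_real (\<Sum>j<n. cmod (d j))"
proof -
  obtain u where u: "\<And>z. cmod (u z) = 1" "\<And>z. z * u z = complex_of_real (cmod z)"
    using exists_phase by metis
  define f where "f j = u (d j)" for j
  have f: "cmod (f j) = 1" "d j * f j = complex_of_real (cmod (d j))" for j
    by (simp_all add: f_def u)
  note PC = unitary_mat_carrier[OF P] and QC = unitary_mat_carrier[OF Q]
  \<comment> \<open>The solution of \<open>Q * X * P = mat_diag n f\<close>.\<close>
  define X where "X = mat_adjoint Q * mat_diag n f * mat_adjoint P"
  have X: "unitary_mat n X"
    unfolding X_def by (intro unitary_mat_mult unitary_mat_adjoint unitary_mat_diag P Q f(1))
  note ac = assoc_mult_mat[of _ n n _ n _ n] mult_carrier_mat[of _ n n _ n]
  have "Q * X * P = (Q * mat_adjoint Q) * mat_diag n f * (mat_adjoint P * P)"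
    unfolding X_def using PC QC by (simp add: ac)
  also have "\<dots> = mat_diag n f"
    unfolding unitary_mat_mult_adjoint[OF Q] unitary_mat_adjoint_mult[OF P]
    by (simp add: left_mult_one_mat[of _ n n] right_mult_one_mat[of _ n n])
  finally have "(\<Sum>j<n. d j * (Q * X * P) $$ (j, j)) = complex_of_real (\<Sum>j<n. cmod (d j))"
    by (simp add: mat_diag_def f(2))
  then show ?thesis
    using that[OF X] trace_pairing_diag[OF PC QC unitary_mat_carrier[OF X], of d] by simp
qed

text \<open>Applied to the squared moduli along a row or column of a unitary matrix: one entry of
  modulus at least 1 uses up the whole norm.\<close>

lemma sum_other_eq_0:
  fixes f :: "'a \<Rightarrow> real"
  assumes "finite A" "\<And>x. x \<in> A \<Longrightarrow> f x \<ge> 0" "sum f A \<le> 1" "a \<in> A" "f a \<ge> 1" "b \<in> A" "b \<noteq> a"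
  shows "f b = 0"
proof -
  have "sum f {a, b} \<le> sum f A" using assms by (intro sum_mono2) auto
  then show ?thesis using assms(2)[OF assms(6)] assms(3,5,7) by simp
qed

lemma cmod_unitary_entry_le_1:
  assumes X: "unitary_mat n X" and ij: "i < n" "j < n"
  shows "cmod (X $$ (i, j)) \<le> 1"
proof -
  have "(cmod (X $$ (i, j)))\<^sup>2 \<le> (\<Sum>i<n. (cmod (X $$ (i, j)))\<^sup>2)"
    using ij by (intro member_le_sum) auto
  then show ?thesis using unitary_mat_col_norm[OF X ij(2)] by (simp add: abs_square_le_1)
qed

lemma double_sum_nonneg_eq_0:
  fixes f :: "nat \<Rightarrow> nat \<Rightarrow> real"
  assumes nonneg: "\<And>i j. i < m \<Longrightarrow> j < n \<Longrightarrow> f i j \<ge> 0"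
    and sum: "(\<Sum>i<m. \<Sum>j<n. f i j) = 0" and i: "i < m" and j: "j < n"
  shows "f i j = 0"
proof -
  have "(\<Sum>(i, j)\<in>{..<m} \<times> {..<n}. f i j) = 0" using sum by (simp add: sum.cartesian_product)
  then have "\<forall>(i, j)\<in>{..<m} \<times> {..<n}. f i j = 0"
    by (subst (asm) sum_nonneg_eq_0_iff) (use nonneg in auto)
  then show ?thesis using i j by auto
qed

lemma sum_cmod_diag_le_l1_norm:
  assumes P: "unitary_mat n P" and Q: "unitary_mat n Q" and B: "B = P * mat_diag n d * Q"
  shows "(\<Sum>j<n. cmod (d j)) \<le> l1_norm_mat B"
    and "(\<Sum>j<n. cmod (d j)) = l1_norm_mat B \<Longrightarrow> sparse_mat n B"
proof -
  obtain X where X: "unitary_mat n X"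
    and BX: "(\<Sum>m<n. \<Sum>k<n. B $$ (m, k) * X $$ (k, m)) = complex_of_real (\<Sum>j<n. cmod (d j))"
    using exists_dual_unitary[OF P Q, of d] unfolding B by blast
  have BC: "B \<in> carrier_mat n n"
    using unitary_mat_carrier[OF P] unitary_mat_carrier[OF Q] by (simp add: B mult_carrier_mat[of _ n n _ n])
  have l1: "l1_norm_mat B = (\<Sum>m<n. \<Sum>k<n. cmod (B $$ (m, k)))"
    using BC by (simp add: l1_norm_mat_def)
  have le: "Re (B $$ (m, k) * X $$ (k, m)) \<le> cmod (B $$ (m, k)) * cmod (X $$ (k, m))" for m k
    unfolding norm_mult[symmetric] by (rule complex_Re_le_cmod)
  have X1: "cmod (B $$ (m, k)) * cmod (X $$ (k, m)) \<le> cmod (B $$ (m, k))" if "m < n" "k < n" for m k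
    using cmod_unitary_entry_le_1[OF X that(2,1)] by (simp add: mult_left_le)
  \<comment> \<open>The loss of a single entry when \<open>B\<close> is paired with
    \<open>X\<close>. The losses are nonnegative and add up to the difference of the two norms, so
    equality makes each of them vanish.\<close>
  define gap where "gap m k = cmod (B $$ (m, k)) - Re (B $$ (m, k) * X $$ (k, m))" for m k
  have gap_nonneg: "gap m k \<ge> 0" if "m < n" "k < n" for m k
    using le[of m k] X1[OF that] unfolding gap_def by linarith
  have "(\<Sum>j<n. cmod (d j)) = (\<Sum>m<n. \<Sum>k<n. Re (B $$ (m, k) * X $$ (k, m)))"
    using arg_cong[OF BX, of Re] by (simp only: Re_sum Re_complex_of_real)
  then have gap: "l1_norm_mat B - (\<Sum>j<n. cmod (d j)) = (\<Sum>m<n. \<Sum>k<n. gap m k)"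
    by (simp only: l1 sum_subtractf gap_def)
  moreover have "0 \<le> (\<Sum>m<n. \<Sum>k<n. gap m k)"
    by (intro sum_nonneg gap_nonneg) auto
  ultimately show "(\<Sum>j<n. cmod (d j)) \<le> l1_norm_mat B" by linarith
  assume "(\<Sum>j<n. cmod (d j)) = l1_norm_mat B"
  with gap have "(\<Sum>m<n. \<Sum>k<n. gap m k) = 0" by simp
  then have gap0: "gap m k = 0" if "m < n" "k < n" for m k
    using that gap_nonneg by (intro double_sum_nonneg_eq_0[of n n gap]) auto
  \<comment> \<open>A zero loss at a nonzero entry of \<open>B\<close> leaves no room for a modulus
    of \<open>X\<close> below 1.\<close>
  have Xge: "(cmod (X $$ (k, m)))\<^sup>2 \<ge> 1" if "m < n" "k < n" "B $$ (m, k) \<noteq> 0" for m k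
  proof -
    have "cmod (B $$ (m, k)) * 1 \<le> cmod (B $$ (m, k)) * cmod (X $$ (k, m))"
      using le[of m k] gap0[OF that(1,2)] unfolding gap_def by linarith
    moreover have "cmod (B $$ (m, k)) > 0" using that(3) by simp
    ultimately have "1 \<le> cmod (X $$ (k, m))" using mult_le_cancel_left_pos by blast
    then show ?thesis by (rule one_le_power)
  qed
  \<comment> \<open>The pairing transposes indices: two nonzero entries in row \<open>m\<close> of
    \<open>B\<close> give two entries of modulus at least 1 in column \<open>m\<close> of
    \<open>X\<close>.\<close>
  have "k = k'" if "m < n" "k < n" "k' < n" "B $$ (m, k) \<noteq> 0" "B $$ (m, k') \<noteq> 0" for m k k'
  proof (rule ccontr)
    assume "k \<noteq> k'"
    then have "(cmod (X $$ (k', m)))\<^sup>2 = 0"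
      by (intro sum_other_eq_0[of "{..<n}" "\<lambda>i. (cmod (X $$ (i, m)))\<^sup>2" k k'])
        (use that Xge[OF that(1,2,4)] unitary_mat_col_norm[OF X that(1)] in simp_all)
    then show False using Xge[OF that(1,3,5)] by simp
  qed
  moreover have "m = m'" if "k < n" "m < n" "m' < n" "B $$ (m, k) \<noteq> 0" "B $$ (m', k) \<noteq> 0" for k m m'
  proof (rule ccontr)
    assume "m \<noteq> m'"
    then have "(cmod (X $$ (k, m')))\<^sup>2 = 0"
      by (intro sum_other_eq_0[of "{..<n}" "\<lambda>i. (cmod (X $$ (k, i)))\<^sup>2" m m'])
        (use that Xge[OF that(2,1,4)] unitary_mat_row_norm[OF X that(1)] in simp_all)
    then show False using Xge[OF that(3,1,5)] by simp
  qed
  ultimately show "sparse_mat n B" unfolding sparse_mat_def by blast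
qed

lemma sum_inj_le_sum:
  fixes f :: "'b \<Rightarrow> real"
  assumes "finite B" "inj_on g T" "g ` T \<subseteq> B" "\<And>x. x \<in> B \<Longrightarrow> f x \<ge> 0"
  shows "(\<Sum>t\<in>T. f (g t)) \<le> sum f B"
proof -
  have "(\<Sum>t\<in>T. f (g t)) = sum f (g ` T)" using assms(2) by (simp add: sum.reindex)
  also have "\<dots> \<le> sum f B" using assms by (intro sum_mono2) auto
  finally show ?thesis .
qed

text \<open>Pairing \<open>B\<close> with its own conjugate phases gives the entrywise norm exactly.
  By the trace identity this is the sum of the \<open>d j\<close> weighted by the diagonal of
  \<open>Q * X * P\<close>, and sparsity bounds those weights by 1.\<close>

lemma l1_norm_le_sum_cmod_diag:
  assumes P: "unitary_mat n P" and Q: "unitary_mat n Q" and B: "B = P * mat_diag n d * Q"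
    and sparse: "sparse_mat n B"
  shows "l1_norm_mat B \<le> (\<Sum>j<n. cmod (d j))"
proof -
  note PC = unitary_mat_carrier[OF P] and QC = unitary_mat_carrier[OF Q]
  have BC: "B \<in> carrier_mat n n" using PC QC by (simp add: B mult_carrier_mat[of _ n n _ n])
  obtain u where u: "\<And>z. cmod (u z) = 1" "\<And>z. z * u z = complex_of_real (cmod z)"
    using exists_phase by metis
  \<comment> \<open>Zero entries of \<open>B\<close> get 0 here rather than a phase, so sums against
    \<open>X\<close> run only over the support \<open>T\<close>.\<close>
  define X where "X = mat n n (\<lambda>(k, m). if B $$ (m, k) = 0 then 0 else u (B $$ (m, k)))"
  have X: "X \<in> carrier_mat n n" by (simp add: X_def)
  define T where "T = {(m, k). m < n \<and> k < n \<and> B $$ (m, k) \<noteq> 0}"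
  have T: "T \<subseteq> {..<n} \<times> {..<n}" by (auto simp: T_def)
  have inj: "inj_on fst T" "inj_on snd T"
    using sparse unfolding sparse_mat_def T_def inj_on_def by auto
  have contr: "cmod ((Q * X * P) $$ (j, j)) \<le> 1" if j: "j < n" for j
  proof -
    have "(Q * X * P) $$ (j, j) = (\<Sum>m<n. (Q * X) $$ (j, m) * P $$ (m, j))"
      using j PC QC X by (intro index_mult_mat_sum) auto
    also have "\<dots> = (\<Sum>m<n. \<Sum>k<n. Q $$ (j, k) * X $$ (k, m) * P $$ (m, j))"
      using j by (intro sum.cong) (auto simp only: index_mult_mat_sum[OF QC X] lessThan_iff sum_distrib_right)
    also have "\<dots> = (\<Sum>t\<in>{..<n} \<times> {..<n}. Q $$ (j, snd t) * X $$ (snd t, fst t) * P $$ (fst t, j))"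
      by (simp add: sum.cartesian_product case_prod_unfold)
    also have "\<dots> = (\<Sum>t\<in>T. Q $$ (j, snd t) * X $$ (snd t, fst t) * P $$ (fst t, j))"
      by (rule sum.mono_neutral_right) (use T in \<open>auto simp: X_def T_def\<close>)
    finally have "cmod ((Q * X * P) $$ (j, j))
        \<le> (\<Sum>t\<in>T. cmod (Q $$ (j, snd t) * X $$ (snd t, fst t) * P $$ (fst t, j)))"
      by (simp only: norm_sum)
    \<comment> \<open>The inequality 2ab \<le> a^2 + b^2 separates \<open>Q\<close> from
      \<open>P\<close>. By injectivity of the projections each sum over \<open>T\<close> is then at
      most a full row norm of \<open>Q\<close> or column norm of \<open>P\<close>, that is,
      1.\<close>
    also have "\<dots> \<le> (\<Sum>t\<in>T. ((cmod (Q $$ (j, snd t)))\<^sup>2 + (cmod (P $$ (fst t, j)))\<^sup>2) / 2)"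
    proof (rule sum_mono)
      fix t assume "t \<in> T"
      then have "cmod (X $$ (snd t, fst t)) = 1" by (auto simp: T_def X_def u(1))
      then show "cmod (Q $$ (j, snd t) * X $$ (snd t, fst t) * P $$ (fst t, j))
          \<le> ((cmod (Q $$ (j, snd t)))\<^sup>2 + (cmod (P $$ (fst t, j)))\<^sup>2) / 2"
        using sum_squares_bound[of "cmod (Q $$ (j, snd t))" "cmod (P $$ (fst t, j))"]
        by (simp add: norm_mult)
    qed
    also have "\<dots> = ((\<Sum>t\<in>T. (cmod (Q $$ (j, snd t)))\<^sup>2) + (\<Sum>t\<in>T. (cmod (P $$ (fst t, j)))\<^sup>2)) / 2"
      by (simp add: sum.distrib sum_divide_distrib[symmetric])
    also have "(\<Sum>t\<in>T. (cmod (Q $$ (j, snd t)))\<^sup>2) \<le> (\<Sum>k<n. (cmod (Q $$ (j, k)))\<^sup>2)"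
      using T by (intro sum_inj_le_sum inj) auto
    also have "(\<Sum>t\<in>T. (cmod (P $$ (fst t, j)))\<^sup>2) \<le> (\<Sum>m<n. (cmod (P $$ (m, j)))\<^sup>2)"
      using T by (intro sum_inj_le_sum inj) auto
    finally show ?thesis
      by (simp add: unitary_mat_row_norm[OF Q j] unitary_mat_col_norm[OF P j])
  qed
  have "complex_of_real (l1_norm_mat B) = (\<Sum>m<n. \<Sum>k<n. B $$ (m, k) * X $$ (k, m))"
    using BC by (auto simp: l1_norm_mat_def X_def u(2) intro!: sum.cong)
  also have "\<dots> = (\<Sum>j<n. d j * (Q * X * P) $$ (j, j))"
    unfolding B by (rule trace_pairing_diag[OF PC QC X])
  finally have "cmod (complex_of_real (l1_norm_mat B)) \<le> (\<Sum>j<n. cmod (d j * (Q * X * P) $$ (j, j)))"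
    by (simp only: norm_sum)
  also have "\<dots> \<le> (\<Sum>j<n. cmod (d j))"
    using contr by (intro sum_mono) (simp add: norm_mult mult_left_le)
  finally show ?thesis by simp
qed

corollary l1_norm_eq_sum_cmod_diag_iff:
  assumes "unitary_mat n P" "unitary_mat n Q" "B = P * mat_diag n d * Q"
  shows "l1_norm_mat B = (\<Sum>j<n. cmod (d j)) \<longleftrightarrow> sparse_mat n B"
  using sum_cmod_diag_le_l1_norm[OF assms] l1_norm_le_sum_cmod_diag[OF assms]
  by (metis order.antisym)

section \<open>Fourier matrices and adjacency matrices\<close>

lemma fourier_mat_carrier [simp]: "fourier_mat n \<in> carrier_mat n n"
  by (simp add: fourier_mat_def)

text \<open>With the row index as exponent, inner products of columns become geometric sums.\<close>

lemma fourier_mat_index: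
  assumes "m < n" "x < n"
  shows "fourier_mat n $$ (m, x) = complex_of_real (1 / sqrt n) * cnj (cis (2 * pi * x / n)) ^ m"
proof -
  have "exp (- 2 * complex_of_real pi * \<i> * of_nat m * of_nat x / of_nat n)
      = cis (- (m * (2 * pi * x / n)))"
    unfolding cis_conv_exp by (rule arg_cong[of _ _ exp]) (simp add: field_simps)
  also have "\<dots> = cnj (cis (2 * pi * x / n)) ^ m"
    by (simp add: DeMoivre cis_cnj)
  finally show ?thesis using assms by (simp add: fourier_mat_def)
qed

text \<open>The inner product of columns \<open>i\<close> and \<open>j\<close> is the average of the
  powers of \<open>z\<close>, an \<open>n\<close>-th root of unity that equals 1 only for
  \<open>i = j\<close>; otherwise the geometric sum vanishes.\<close>

lemma unitary_fourier_mat: "unitary_mat n (fourier_mat n)"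
proof -
  define w where "w x = cis (2 * pi * real x / real n)" for x
  have "mat_adjoint (fourier_mat n) * fourier_mat n = 1\<^sub>m n"
  proof (rule eq_matI)
    fix i j assume "i < dim_row (1\<^sub>m n)" "j < dim_col (1\<^sub>m n)"
    then have ij: "i < n" "j < n" by auto
    then have n: "n > 0" by simp
    define z where "z = w i * cnj (w j)"
    have F: "fourier_mat n $$ (m, x) = complex_of_real (1 / sqrt n) * cnj (w x) ^ m"
      if "m < n" "x < n" for m x
      using fourier_mat_index[OF that] by (simp add: w_def)
    have n1: "complex_of_real (1 / sqrt n) * complex_of_real (1 / sqrt n) = 1 / of_nat n"
      unfolding of_real_mult[symmetric] by (simp add: field_simps)
    have "(mat_adjoint (fourier_mat n) * fourier_mat n) $$ (i, j)
        = (\<Sum>m<n. mat_adjoint (fourier_mat n) $$ (i, m) * fourier_mat n $$ (m, j))"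
      by (rule index_mult_mat_sum[of _ n _ _ n]) (use ij in auto)
    also have "\<dots> = (\<Sum>m<n. 1 / of_nat n * z ^ m)"
    proof (rule sum.cong)
      fix m assume "m \<in> {..<n}"
      then have m: "m < n" by simp
      have "mat_adjoint (fourier_mat n) $$ (i, m) = complex_of_real (1 / sqrt n) * w i ^ m"
        using m ij by (simp add: F carrier_matD[OF fourier_mat_carrier])
      then have "mat_adjoint (fourier_mat n) $$ (i, m) * fourier_mat n $$ (m, j)
          = (complex_of_real (1 / sqrt n) * complex_of_real (1 / sqrt n)) * (w i ^ m * cnj (w j) ^ m)"
        unfolding F[OF m ij(2)] by (simp only: mult_ac)
      then show "mat_adjoint (fourier_mat n) $$ (i, m) * fourier_mat n $$ (m, j) = 1 / of_nat n * z ^ m"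
        unfolding n1 z_def power_mult_distrib .
    qed simp
    also have "\<dots> = 1 / of_nat n * (\<Sum>m<n. z ^ m)" by (simp add: sum_distrib_left)
    also have "\<dots> = (1\<^sub>m n) $$ (i, j)"
    proof (cases "i = j")
      case True
      then have "z = 1" by (simp add: z_def w_def cis_cnj cis_mult)
      then show ?thesis using True ij n by simp
    next
      case False
      have wn: "w x ^ n = 1" for x
        using n cis_multiple_2pi[of "real x"] by (simp add: w_def DeMoivre)
      \<comment> \<open>The \<open>w x\<close> with \<open>x < n\<close> enumerate the
        \<open>n\<close>-th roots of unity without repetition.\<close>
      have "inj_on w {..<n}"
        using bij_betw_imp_inj_on[OF bij_betw_roots_unity[OF n]] by (simp add: w_def[abs_def])
      then have "w i \<noteq> w j" using False ij by (auto simp: inj_on_def)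
      moreover have "w j * cnj (w j) = 1" by (simp add: w_def cis_cnj cis_mult)
      ultimately have "z \<noteq> 1" unfolding z_def
        by (metis mult.assoc mult.commute mult.right_neutral)
      moreover have "z ^ n = 1"
        using wn by (simp add: z_def power_mult_distrib flip: complex_cnj_power)
      ultimately have "(\<Sum>m<n. z ^ m) = 0" by (simp add: geometric_sum)
      then show ?thesis using False ij by simp
    qed
    finally show "(mat_adjoint (fourier_mat n) * fourier_mat n) $$ (i, j) = (1\<^sub>m n) $$ (i, j)" .
  qed (auto simp: carrier_matD[OF fourier_mat_carrier])
  then show ?thesis by (simp add: unitary_mat_def)
qed

section \<open>Adjacency matrices: symmetry and Frobenius norm\<close>

lemma adjacency_mat_carrier [simp]: "adjacency_mat V E \<sigma> \<in> carrier_mat (card V) (card V)"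
  by (simp add: adjacency_mat_def)

lemma mat_adjoint_adjacency_mat [simp]: "mat_adjoint (adjacency_mat V E \<sigma>) = adjacency_mat V E \<sigma>"
  by (rule eq_matI) (auto simp: adjacency_mat_def insert_commute)

text \<open>An edge has two distinct ends, hence exactly two orderings, and different edges share
  none.\<close>

lemma card_arcs:
  assumes "simple_graph V E"
  shows "card {(a, b) \<in> V \<times> V. {a, b} \<in> E} = 2 * card E"
proof -
  have V: "finite V" and E: "\<And>e. e \<in> E \<Longrightarrow> e \<subseteq> V \<and> card e = 2"
    using assms by (auto simp: simple_graph_def)
  have "finite E" using V E by (intro finite_subset[of E "Pow V"]) auto
  define ends where "ends e = {(a, b). {a, b} = e}" for e :: "'a set"
  have two: "finite (ends e) \<and> card (ends e) = 2" if e: "e \<in> E" for e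
  proof -
    obtain a b where ab: "e = {a, b}" "a \<noteq> b" using conjunct2[OF E[OF e]] unfolding card_2_iff by blast
    then have "ends e = {(a, b), (b, a)}" by (auto simp: ends_def doubleton_eq_iff)
    then show ?thesis using ab(2) by simp
  qed
  have "{(a, b) \<in> V \<times> V. {a, b} \<in> E} = (\<Union>e\<in>E. ends e)"
    using E by (auto simp: ends_def)
  also have "card \<dots> = (\<Sum>e\<in>E. card (ends e))"
    by (rule card_UN_disjoint) (use \<open>finite E\<close> two in \<open>auto simp: ends_def\<close>)
  also have "\<dots> = 2 * card E" using two by simp
  finally show ?thesis .
qed

text \<open>The entries are 0 or 1, so the squared norm counts ordered adjacent pairs; the inverse
  labeling carries the sum from labels to vertices.\<close>

lemma frobenius_norm_adjacency_mat:
  assumes G: "simple_graph V E" and \<sigma>: "vertex_labeling V \<sigma>"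
  shows "frobenius_norm_mat (adjacency_mat V E \<sigma>) = sqrt (2 * real (card E))"
proof -
  let ?N = "card V"
  have V: "finite V" using G by (simp add: simple_graph_def)
  have bij: "bij_betw (inv_into V \<sigma>) {..<?N} V"
    using bij_betw_inv_into \<sigma> by (auto simp: vertex_labeling_def lessThan_atLeast0)
  define g :: "'a \<Rightarrow> 'a \<Rightarrow> real" where "g a b = (if {a, b} \<in> E then 1 else 0)" for a b
  have "(\<Sum>i<?N. \<Sum>j<?N. (cmod (adjacency_mat V E \<sigma> $$ (i, j)))\<^sup>2)
      = (\<Sum>i<?N. \<Sum>j<?N. g (inv_into V \<sigma> i) (inv_into V \<sigma> j))"
    by (intro sum.cong) (auto simp: adjacency_mat_def g_def)
  also have "\<dots> = (\<Sum>i<?N. \<Sum>b\<in>V. g (inv_into V \<sigma> i) b)"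
    by (intro sum.cong refl sum.reindex_bij_betw[OF bij])
  also have "\<dots> = (\<Sum>a\<in>V. \<Sum>b\<in>V. g a b)"
    by (rule sum.reindex_bij_betw[OF bij])
  also have "\<dots> = (\<Sum>t\<in>V \<times> V. if t \<in> {(a, b). {a, b} \<in> E} then 1 else 0)"
    unfolding sum.cartesian_product by (intro sum.cong) (auto simp: g_def)
  also have "\<dots> = real (card {(a, b) \<in> V \<times> V. {a, b} \<in> E})"
    using V by (simp add: sum.If_cases Int_def case_prod_unfold mem_Times_iff)
  also have "\<dots> = 2 * real (card E)" using card_arcs[OF G] by simp
  finally show ?thesis
    by (simp add: frobenius_norm_mat_def carrier_matD[OF adjacency_mat_carrier])
qed

lemma sparse_mat_iff_card:
  "sparse_mat n B \<longleftrightarrow>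
    (\<forall>m<n. card {k \<in> {0..<n}. B $$ (m, k) \<noteq> 0} \<le> 1) \<and>
    (\<forall>k<n. card {m \<in> {0..<n}. B $$ (m, k) \<noteq> 0} \<le> 1)"
proof -
  have *: "card {k \<in> {0..<n}. p k} \<le> 1 \<longleftrightarrow> (\<forall>k<n. \<forall>k'<n. p k \<longrightarrow> p k' \<longrightarrow> k = k')" for p
    by (auto simp: card_le_Suc0_iff_eq)
  show ?thesis unfolding sparse_mat_def * ..
qed

theorem theorem2p1:
  fixes V :: "'v set" and E :: "'v set set" and \<sigma> :: "'v \<Rightarrow> nat" and N s :: nat
  assumes "simple_graph V E"
    and "N = card V"
    and "s = card E"
    and "s > 0"
    and "vertex_labeling V \<sigma>"
  shows "fourier_ratio (adjacency_mat V E \<sigma>) = graph_energy V E / sqrt (2 * real s) \<longleftrightarrow>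
    (\<forall>m<N. card {n \<in> {0..<N}. fourier_hat (adjacency_mat V E \<sigma>) $$ (m, n) \<noteq> 0} \<le> 1) \<and>
    (\<forall>n<N. card {m \<in> {0..<N}. fourier_hat (adjacency_mat V E \<sigma>) $$ (m, n) \<noteq> 0} \<le> 1)"
proof -
  define A where "A = adjacency_mat V E \<sigma>"
  define F where "F = fourier_mat N"
  have A: "A \<in> carrier_mat N N" "mat_adjoint A = A" by (simp_all add: A_def assms(2))
  have F: "unitary_mat N F" unfolding F_def by (rule unitary_fourier_mat)
  note FC = unitary_mat_carrier[OF F]
  have hat: "fourier_hat A = F * A * F" using A by (simp add: fourier_hat_def F_def)
  obtain U d where U: "unitary_mat N U" and AU: "A = U * mat_diag N d * mat_adjoint U"
    using hermitian_spectral_theorem[OF A] by blast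
  note UC = unitary_mat_carrier[OF U]
  \<comment> \<open>Since the right factor is \<open>F\<close> and not its adjoint,
    \<open>F * U\<close> and \<open>mat_adjoint U * F\<close> need not be adjoint to each other.
    Hence the norm comparison allows two independent unitaries \<open>P\<close> and
    \<open>Q\<close>.\<close>
  have "F * A * F = (F * U) * mat_diag N d * (mat_adjoint U * F)"
    unfolding AU using UC FC
    by (simp add: assoc_mult_mat[of _ N N _ N _ N] mult_carrier_mat[of _ N N _ N])
  then have l1: "l1_norm_mat (fourier_hat A) = (\<Sum>j<N. cmod (d j)) \<longleftrightarrow> sparse_mat N (fourier_hat A)"
    unfolding hat
    by (intro l1_norm_eq_sum_cmod_diag_iff[of _ "F * U" "mat_adjoint U * F"] unitary_mat_mult
        unitary_mat_adjoint F U)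
  \<comment> \<open>The energy is defined through an arbitrary labeling;
    \<open>graph_energy_eq\<close> moves it to \<open>\<sigma>\<close>.\<close>
  have energy: "graph_energy V E = (\<Sum>j<N. cmod (d j))"
    unfolding graph_energy_eq[OF assms(5)] A_def[symmetric] by (rule sum_cmod_proots_char_poly[OF U AU])
  have "frobenius_norm_mat (fourier_hat A) = frobenius_norm_mat A"
    unfolding hat frobenius_norm_mat_unitary_right[OF F mult_carrier_mat[OF FC A(1)]]
    by (rule frobenius_norm_mat_unitary_left[OF F A(1)])
  then have "frobenius_norm_mat (fourier_hat A) = sqrt (2 * real s)"
    using frobenius_norm_adjacency_mat[OF assms(1,5)] by (simp add: A_def assms(3))
  \<comment> \<open>Both quotients have the denominator \<open>sqrt (2 * real s)\<close>, which is
    nonzero because \<open>s > 0\<close>.\<close>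
  then have "fourier_ratio A = graph_energy V E / sqrt (2 * real s)
      \<longleftrightarrow> l1_norm_mat (fourier_hat A) = (\<Sum>j<N. cmod (d j))"
    using assms(4) by (simp add: fourier_ratio_def energy)
  also note l1
  finally show ?thesis unfolding sparse_mat_iff_card A_def .
qed

end
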